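(* Let $G=(V,E)$ be a directed graph in which every node has out-degree at least $1$, let $\alpha\in(0,1)$, and let $s,t\in V$, $\delta>0$ and $0<\epsilon_r<\alpha$. Consider the idealized FAST-PPR algorithm with exact frontier information: if $s\in T_t(\epsilon_r)$ it returns $\pi_s(t)$; otherwise it generates $k=c\epsilon_r/\delta$ independent walks $RW(s,L_i)$, $L_i\sim Geom(\alpha)$, lets $H_i$ be the first node of the $i$-th walk lying in $F_t(\epsilon_r)$ (with $H_i=\bot$ if there is none), and returns $\widehat{\pi}_s(t)=\frac1k\sum_{i=1}^k \pi_{H_i}(t)$, where $\pi_{\bot}(t):=0$, and where $c=\max(48\cdot 8e\ln(100),\,4\log_2(100))$. Then with probability greater than $0.99$, $$|\pi_s(t)-\widehat{\pi}_s(t)|\leq \max(\delta,\pi_s(t))/4.$$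
   Context: $Geom(\alpha)$ is the distribution on $\{0,1,2,\dots\}$ with $\mathbb{P}[L=i]=\alpha(1-\alpha)^i$; $RW(u,L)=\{u=V_0,V_1,\dots,V_L\}$ is the walk from $u$ that moves to a uniformly random out-neighbour at each step. The personalized PageRank is $\pi_u(v)=\mathbb{P}[V_L=v]$ for $L\sim Geom(\alpha)$ independent of the walk. The target set is $T_t(\epsilon_r)=\{w:\pi_w(t)>\epsilon_r\}$ and the frontier set is $F_t(\epsilon_r)=\big(\bigcup_{v\in T_t(\epsilon_r)}\mathcal{N}^{in}(v)\big)\setminus T_t(\epsilon_r)$, where $\mathcal{N}^{in}(v)$ is the set of in-neighbours of $v$. "Exact frontier information" means that the sets $T_t(\epsilon_r)$, $F_t(\epsilon_r)$ and the values $\pi_w(t)$ for $w\in T_t(\epsilon_r)\cup F_t(\epsilon_r)$ are known exactly. The number of walks $k$ is $c\epsilon_r/\delta$ (rounded up to an integer if necessary). *)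

theory Defs
  imports "HOL-Probability.Probability" "Graph_Theory.Pair_Digraph"
begin

definition out_nbrs :: "'a pair_pre_digraph \<Rightarrow> 'a \<Rightarrow> 'a set" where
  "out_nbrs G u = {v. (u, v) \<in> parcs G}"

definition in_nbrs :: "'a pair_pre_digraph \<Rightarrow> 'a \<Rightarrow> 'a set" where
  "in_nbrs G v = {u. (u, v) \<in> parcs G}"

text \<open>The law of the list $[V_0, \dots, V_l]$ of nodes visited by a random walk of fixed length
  \<open>l\<close>.  As \<^const>\<open>pmf_of_set\<close> is meaningful only on finite nonempty sets, so is the walk only
  when the out-neighbourhoods are.  This is guaranteed by \<open>out_degree G u \<ge> 1\<close> for every node \<open>u\<close>, since
  \<^const>\<open>out_degree\<close> is a \<^const>\<open>card\<close> and hence $0$ on an infinite set of arcs.\<close>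

primrec walk_pmf :: "'a pair_pre_digraph \<Rightarrow> 'a \<Rightarrow> nat \<Rightarrow> 'a list pmf" where
  "walk_pmf G u 0 = return_pmf [u]"
| "walk_pmf G u (Suc l) =
     map_pmf ((#) u) (bind_pmf (pmf_of_set (out_nbrs G u)) (\<lambda>v. walk_pmf G v l))"

text \<open>The law of $RW(u, L)$ for an independent $L \sim Geom(\alpha)$; the library's
  \<^const>\<open>geometric_pmf\<close> is the distribution on $\{0, 1, \dots\}$ with
  $P[L = i] = \alpha (1 - \alpha)^i$.\<close>

definition RW :: "'a pair_pre_digraph \<Rightarrow> real \<Rightarrow> 'a \<Rightarrow> 'a list pmf" where
  "RW G \<alpha> u = bind_pmf (geometric_pmf \<alpha>) (walk_pmf G u)"

definition ppr :: "'a pair_pre_digraph \<Rightarrow> real \<Rightarrow> 'a \<Rightarrow> 'a \<Rightarrow> real" where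
  "ppr G \<alpha> u v = measure_pmf.prob (RW G \<alpha> u) {ws. last ws = v}"

definition target_set :: "'a pair_pre_digraph \<Rightarrow> real \<Rightarrow> real \<Rightarrow> 'a \<Rightarrow> 'a set" where
  "target_set G \<alpha> \<epsilon>\<^sub>r t = {w \<in> pverts G. ppr G \<alpha> w t > \<epsilon>\<^sub>r}"

definition frontier_set :: "'a pair_pre_digraph \<Rightarrow> real \<Rightarrow> real \<Rightarrow> 'a \<Rightarrow> 'a set" where
  "frontier_set G \<alpha> \<epsilon>\<^sub>r t =
     (\<Union>v\<in>target_set G \<alpha> \<epsilon>\<^sub>r t. in_nbrs G v) - target_set G \<alpha> \<epsilon>\<^sub>r t"

text \<open>\<^const>\<open>None\<close> plays the role of $\bot$.\<close>

definition first_hit :: "'a set \<Rightarrow> 'a list \<Rightarrow> 'a option" where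
  "first_hit F ws = find (\<lambda>w. w \<in> F) ws"

definition hit_value :: "'a pair_pre_digraph \<Rightarrow> real \<Rightarrow> 'a \<Rightarrow> 'a option \<Rightarrow> real" where
  "hit_value G \<alpha> t h = (case h of None \<Rightarrow> 0 | Some w \<Rightarrow> ppr G \<alpha> w t)"

definition fast_ppr_const :: real where
  "fast_ppr_const = max (48 * (8 * exp 1) * ln 100) (4 * log 2 100)"

definition num_walks :: "real \<Rightarrow> real \<Rightarrow> nat" where
  "num_walks \<epsilon>\<^sub>r \<delta> = nat \<lceil>fast_ppr_const * \<epsilon>\<^sub>r / \<delta>\<rceil>"

text \<open>The distribution of the value returned by the idealized algorithm;
  \<^const>\<open>replicate_pmf\<close> draws the walks independently.\<close>

definition fast_ppr ::
    "'a pair_pre_digraph \<Rightarrow> real \<Rightarrow> real \<Rightarrow> real \<Rightarrow> 'a \<Rightarrow> 'a \<Rightarrow> real pmf" where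
  "fast_ppr G \<alpha> \<epsilon>\<^sub>r \<delta> s t =
     (if s \<in> target_set G \<alpha> \<epsilon>\<^sub>r t then return_pmf (ppr G \<alpha> s t)
      else let k = num_walks \<epsilon>\<^sub>r \<delta> in
        map_pmf
          (\<lambda>walks. (\<Sum>ws\<leftarrow>walks. hit_value G \<alpha> t (first_hit (frontier_set G \<alpha> \<epsilon>\<^sub>r t) ws)) / real k)
          (replicate_pmf k (RW G \<alpha> s)))"

end

theory Submission
  imports Defs
begin

text \<open>By the memorylessness of the geometric distribution, the remainder of a walk after its first
  step is again a walk of geometric length.  Hence off the target set both \<open>\<pi>\<^sub>u(t)\<close> and the
  expected value of \<open>\<pi>\<^sub>H(t)\<close> for a walk from \<open>u\<close> satisfy, at non-frontier nodes, the recursion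
  \<open>g(u) = (1 - \<alpha>) \<cdot> (average of g over the out-neighbours of u)\<close>, and they agree on
  the frontier.  The recursion is a contraction, so they agree everywhere off the target set: the
  estimator is unbiased.  A single sample lies in $[0, \epsilon_r]$, so its variance is at most
  \<open>\<epsilon>\<^sub>r \<pi>\<^sub>s(t)\<close>.  The constant \<open>c\<close> is so large that Chebyshev's inequality, with failure
  probability at most \<open>16 / c\<close>, already suffices in place of Chernoff bounds.\<close>

section \<open>Expectations over probability mass functions\<close>

lemma integrable_measure_pmf_bounded:
  fixes f :: "'a \<Rightarrow> real"
  assumes "\<And>x. x \<in> set_pmf p \<Longrightarrow> \<bar>f x\<bar> \<le> B"
  shows "integrable (measure_pmf p) f"
  by (rule measure_pmf.integrable_const_bound[of _ B]) (use assms in \<open>auto simp: AE_measure_pmf_iff\<close>)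

lemma abs_expectation_le:
  fixes f :: "'a \<Rightarrow> real"
  assumes "\<And>x. x \<in> set_pmf p \<Longrightarrow> \<bar>f x\<bar> \<le> B"
  shows "\<bar>measure_pmf.expectation p f\<bar> \<le> B"
proof -
  have int: "integrable (measure_pmf p) f"
    by (rule integrable_measure_pmf_bounded) (rule assms)
  have "measure_pmf.expectation p f \<le> B"
    by (rule measure_pmf.integral_le_const[OF int])
       (use assms in \<open>force simp: AE_measure_pmf_iff abs_le_iff\<close>)
  moreover have "- B \<le> measure_pmf.expectation p f"
    by (rule measure_pmf.integral_ge_const[OF int])
       (use assms in \<open>force simp: AE_measure_pmf_iff abs_le_iff\<close>)
  ultimately show ?thesis by simp
qed

lemma expectation_bind_pmf:
  fixes f :: "'b \<Rightarrow> real"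
  assumes bd: "\<And>x y. x \<in> set_pmf p \<Longrightarrow> y \<in> set_pmf (q x) \<Longrightarrow> \<bar>f y\<bar> \<le> B"
  shows "measure_pmf.expectation (bind_pmf p q) f =
           measure_pmf.expectation p (\<lambda>x. measure_pmf.expectation (q x) f)"
proof -
  \<comment> \<open>Cutting \<open>f\<close> off outside the support changes none of the
    expectations and gives a function bounded by \<open>B\<close> everywhere.\<close>
  define g where "g y = (if y \<in> set_pmf (bind_pmf p q) then f y else 0)" for y
  have "0 \<le> B"
  proof -
    obtain x where "x \<in> set_pmf p" using set_pmf_not_empty[of p] by blast
    moreover obtain y where "y \<in> set_pmf (q x)" using set_pmf_not_empty[of "q x"] by blast
    ultimately show ?thesis using bd[of x y] by linarith
  qed
  then have g_bd: "\<bar>g y\<bar> \<le> B" for y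
    using bd by (auto simp: g_def)
  have "measure_pmf.expectation (bind_pmf p q) f = measure_pmf.expectation (bind_pmf p q) g"
    by (rule integral_cong_AE) (auto simp: AE_measure_pmf_iff g_def)
  also have "\<dots> = measure_pmf.expectation p (\<lambda>x. measure_pmf.expectation (q x) g)"
    unfolding measure_pmf_bind
    by (rule integral_bind[where K = "count_space UNIV" and B = B and B' = 1])
       (auto simp: g_bd measure_pmf.emeasure_space_1 space_subprob_algebra subprob_space_measure_pmf
         intro: measure_pmf.finite_measure_axioms simp del: space_measure_pmf)
  also have "\<dots> = measure_pmf.expectation p (\<lambda>x. measure_pmf.expectation (q x) f)"
    by (rule integral_cong_AE)
       (auto simp: AE_measure_pmf_iff g_def intro!: integral_cong_AE)
  finally show ?thesis .
qed

section \<open>Sums of independent samples\<close>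

lemma abs_sum_list_le:
  fixes Z :: "'a \<Rightarrow> real"
  assumes "\<And>x. x \<in> set xs \<Longrightarrow> \<bar>Z x\<bar> \<le> B"
  shows "\<bar>\<Sum>x\<leftarrow>xs. Z x\<bar> \<le> real (length xs) * B"
  using assms
proof (induction xs)
  case (Cons a xs)
  then have "\<bar>Z a\<bar> \<le> B" "\<bar>\<Sum>x\<leftarrow>xs. Z x\<bar> \<le> real (length xs) * B" by auto
  then show ?case by (simp add: algebra_simps)
qed simp

text \<open>Splits off the first sample. The bound is asked only of lists of the right length over
  the support, since sums of samples need not be bounded uniformly in the length.\<close>

lemma expectation_replicate_pmf_Suc:
  fixes f :: "'a list \<Rightarrow> real"
  assumes "\<And>xs. set xs \<subseteq> set_pmf p \<Longrightarrow> length xs = Suc n \<Longrightarrow> \<bar>f xs\<bar> \<le> B"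
  shows "measure_pmf.expectation (replicate_pmf (Suc n) p) f =
    measure_pmf.expectation p (\<lambda>x. measure_pmf.expectation (replicate_pmf n p) (\<lambda>xs. f (x # xs)))"
proof -
  have bd: "\<bar>f (x # xs)\<bar> \<le> B" if "x \<in> set_pmf p" "xs \<in> set_pmf (replicate_pmf n p)" for x xs
    by (rule assms) (use that in \<open>auto simp: set_replicate_pmf\<close>)
  have "replicate_pmf (Suc n) p = bind_pmf p (\<lambda>x. map_pmf ((#) x) (replicate_pmf n p))"
    by (simp add: map_pmf_def)
  then show ?thesis
    using bd by (auto simp del: replicate_pmf.simps intro!: expectation_bind_pmf[where B = B, THEN trans])
qed

text \<open>Independence makes the variances add. The induction step for the second moment uses the
  vanishing mean, so both claims share one induction.\<close>

lemma replicate_pmf_centered_moments: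
  fixes Z :: "'a \<Rightarrow> real"
  assumes bd: "\<And>x. x \<in> set_pmf p \<Longrightarrow> \<bar>Z x\<bar> \<le> B"
    and mean: "measure_pmf.expectation p Z = 0"
  shows "measure_pmf.expectation (replicate_pmf n p) (\<lambda>xs. \<Sum>x\<leftarrow>xs. Z x) = 0"
    and "measure_pmf.expectation (replicate_pmf n p) (\<lambda>xs. (\<Sum>x\<leftarrow>xs. Z x)\<^sup>2) =
           real n * measure_pmf.expectation p (\<lambda>x. (Z x)\<^sup>2)"
proof (induction n)
  case (Suc n)
  let ?S = "\<lambda>xs. \<Sum>x\<leftarrow>xs. Z x"
  have S_bd: "\<bar>?S xs\<bar> \<le> real m * B" if "set xs \<subseteq> set_pmf p" "length xs = m" for xs m
    using abs_sum_list_le[of xs Z B] bd that by blast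
  have S2_bd: "\<bar>(?S xs)\<^sup>2\<bar> \<le> (real m * B)\<^sup>2" if "set xs \<subseteq> set_pmf p" "length xs = m" for xs m
    using S_bd[OF that] by (simp add: abs_le_square_iff[symmetric])
  have S_int [simp]: "integrable (measure_pmf (replicate_pmf n p)) ?S"
    by (rule integrable_measure_pmf_bounded, rule S_bd) (auto simp: set_replicate_pmf)
  have S2_int [simp]: "integrable (measure_pmf (replicate_pmf n p)) (\<lambda>xs. (?S xs)\<^sup>2)"
    by (rule integrable_measure_pmf_bounded, rule S2_bd) (auto simp: set_replicate_pmf)
  have Z_int [simp]: "integrable (measure_pmf p) Z"
    by (rule integrable_measure_pmf_bounded) (rule bd)
  have Z2_int [simp]: "integrable (measure_pmf p) (\<lambda>x. (Z x)\<^sup>2)"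
    by (rule integrable_measure_pmf_bounded[where B = "B\<^sup>2"])
       (use bd in \<open>force simp: abs_le_square_iff[symmetric]\<close>)
  {
    case 1
    show ?case
      by (subst expectation_replicate_pmf_Suc[OF S_bd]) (use Suc.IH(1) mean in simp_all)
  next
    case 2
    \<comment> \<open>For fixed \<open>x\<close> the cross term is \<open>2 * Z x\<close> times the
      mean of the remaining sum, which is 0 by the first claim.\<close>
    have "measure_pmf.expectation (replicate_pmf n p) (\<lambda>xs. (Z x + ?S xs)\<^sup>2) =
            (Z x)\<^sup>2 + real n * measure_pmf.expectation p (\<lambda>x. (Z x)\<^sup>2)" for x
      using Suc.IH by (simp add: power2_sum algebra_simps)
    then show ?case
      by (subst expectation_replicate_pmf_Suc[OF S2_bd]) (simp_all add: algebra_simps)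
  }
qed simp_all

text \<open>Chebyshev's inequality for the centred sum. Since \<open>Y\<close> takes values between
  0 and \<open>b\<close>, its square is at most \<open>b * Y\<close>, so the variance is at most
  \<open>b * m\<close>; the factor \<open>m\<close> later cancels against the squared
  tolerance.\<close>

lemma prob_replicate_pmf_deviation:
  fixes Y :: "'a \<Rightarrow> real"
  assumes nonneg: "\<And>x. x \<in> set_pmf p \<Longrightarrow> 0 \<le> Y x"
    and le: "\<And>x. x \<in> set_pmf p \<Longrightarrow> Y x \<le> b"
    and k: "k > 0" and a: "a > 0"
  defines "m \<equiv> measure_pmf.expectation p Y"
  shows "measure_pmf.prob (replicate_pmf k p) {xs. \<bar>(\<Sum>x\<leftarrow>xs. Y x) / real k - m\<bar> \<ge> a}
           \<le> b * m / (real k * a\<^sup>2)"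
proof -
  let ?R = "measure_pmf (replicate_pmf k p)"
  define Z where "Z x = Y x - m" for x
  let ?S = "\<lambda>xs. \<Sum>x\<leftarrow>xs. Z x"
  have Y_bd: "\<bar>Y x\<bar> \<le> b" if "x \<in> set_pmf p" for x
    using nonneg[OF that] le[OF that] by simp
  have Y2_le: "(Y x)\<^sup>2 \<le> b * Y x" if "x \<in> set_pmf p" for x
    using nonneg[OF that] le[OF that] by (simp add: power2_eq_square mult_right_mono)
  have Y_int [simp]: "integrable (measure_pmf p) Y"
    by (rule integrable_measure_pmf_bounded) (rule Y_bd)
  have Y2_int [simp]: "integrable (measure_pmf p) (\<lambda>x. (Y x)\<^sup>2)"
    by (rule integrable_measure_pmf_bounded[where B = "b\<^sup>2"])
       (use Y_bd in \<open>force simp: abs_le_square_iff[symmetric]\<close>)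
  have Z_bd: "\<bar>Z x\<bar> \<le> b + \<bar>m\<bar>" if "x \<in> set_pmf p" for x
    using Y_bd[OF that] unfolding Z_def by linarith
  have Z_mean: "measure_pmf.expectation p Z = 0"
    unfolding Z_def by (simp add: m_def)
  note moments = replicate_pmf_centered_moments[OF Z_bd Z_mean]
  have "measure_pmf.expectation p (\<lambda>x. (Z x)\<^sup>2) = measure_pmf.expectation p (\<lambda>x. (Y x)\<^sup>2) - m\<^sup>2"
    unfolding Z_def by (simp add: power2_diff) (simp add: m_def power2_eq_square)
  also have "\<dots> \<le> measure_pmf.expectation p (\<lambda>x. (Y x)\<^sup>2)" by simp
  also have "\<dots> \<le> measure_pmf.expectation p (\<lambda>x. b * Y x)"
    by (rule integral_mono_AE) (auto simp: AE_measure_pmf_iff Y2_le)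
  finally have var: "measure_pmf.expectation p (\<lambda>x. (Z x)\<^sup>2) \<le> b * m" by (simp add: m_def)
  have S_int: "integrable ?R (\<lambda>xs. (?S xs)\<^sup>2)"
  proof (rule integrable_measure_pmf_bounded)
    fix xs assume "xs \<in> set_pmf (replicate_pmf k p)"
    then show "\<bar>(?S xs)\<^sup>2\<bar> \<le> (real k * (b + \<bar>m\<bar>))\<^sup>2"
      using abs_sum_list_le[of xs Z "b + \<bar>m\<bar>"] Z_bd
      by (auto simp: set_replicate_pmf abs_le_square_iff[symmetric] subset_iff)
  qed
  have S_eq: "?S xs = (\<Sum>x\<leftarrow>xs. Y x) - real (length xs) * m" for xs
    by (induction xs) (auto simp: Z_def algebra_simps)
  \<comment> \<open>The events need agree only on lists of length \<open>k\<close>, which carry all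
    the mass.\<close>
  have "measure ?R {xs. \<bar>(\<Sum>x\<leftarrow>xs. Y x) / real k - m\<bar> \<ge> a} = measure ?R {xs. \<bar>?S xs\<bar> \<ge> real k * a}"
  proof (rule measure_pmf.finite_measure_eq_AE)
    have "a \<le> \<bar>(\<Sum>x\<leftarrow>xs. Y x) / real k - m\<bar> \<longleftrightarrow> real k * a \<le> \<bar>?S xs\<bar>" if "length xs = k" for xs
    proof -
      have "?S xs = real k * ((\<Sum>x\<leftarrow>xs. Y x) / real k - m)"
        using k that by (simp add: S_eq right_diff_distrib)
      then show ?thesis using k by (simp add: abs_mult)
    qed
    then show "AE xs in ?R. (xs \<in> {xs. \<bar>(\<Sum>x\<leftarrow>xs. Y x) / real k - m\<bar> \<ge> a}) =
        (xs \<in> {xs. \<bar>?S xs\<bar> \<ge> real k * a})"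
      by (auto simp: AE_measure_pmf_iff set_replicate_pmf)
  qed auto
  also have "\<dots> \<le> real k * measure_pmf.expectation p (\<lambda>x. (Z x)\<^sup>2) / (real k * a)\<^sup>2"
    using measure_pmf.Chebyshev_inequality[OF _ S_int, of "real k * a"] k a moments by simp
  also have "\<dots> \<le> real k * (b * m) / (real k * a)\<^sup>2"
    by (intro divide_right_mono mult_left_mono var) auto
  also have "\<dots> = b * m / (real k * a\<^sup>2)"
    using k by (simp add: power2_eq_square)
  finally show ?thesis .
qed

section \<open>Walks of geometric length\<close>

locale ppr_digraph = pair_wf_digraph G for G :: "'a pair_pre_digraph" +
  fixes \<alpha> :: real
  assumes out_degree_ge_1: "\<And>u. u \<in> pverts G \<Longrightarrow> out_degree G u \<ge> 1"
    and \<alpha>_pos: "0 < \<alpha>" and \<alpha>_less_1: "\<alpha> < 1"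
begin

lemma set_pmf_of_out_nbrs:
  assumes "u \<in> pverts G"
  shows "set_pmf (pmf_of_set (out_nbrs G u)) = out_nbrs G u"
proof -
  have "card (out_arcs (with_proj G) u) \<ge> 1"
    using out_degree_ge_1[OF assms] by (simp add: out_degree_def)
  then have "finite (out_arcs (with_proj G) u)" "out_arcs (with_proj G) u \<noteq> {}"
    by (auto intro: card_ge_0_finite)
  moreover have "out_nbrs G u = snd ` out_arcs (with_proj G) u"
    by (force simp: out_nbrs_def out_arcs_def)
  ultimately show ?thesis by (simp add: set_pmf_of_set)
qed

lemma out_nbrs_in_pverts: "v \<in> out_nbrs G u \<Longrightarrow> v \<in> pverts G"
  by (auto simp: out_nbrs_def dest: in_arcsD2)

text \<open>A geometric length is 0 with probability \<alpha> and otherwise one more than a fresh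
  geometric length.\<close>

lemma RW_unfold:
  "RW G \<alpha> u = bind_pmf (bernoulli_pmf \<alpha>) (\<lambda>b. if b then return_pmf [u]
     else map_pmf ((#) u) (bind_pmf (pmf_of_set (out_nbrs G u)) (RW G \<alpha>)))"
proof -
  have "RW G \<alpha> u = bind_pmf (bernoulli_pmf \<alpha>) (\<lambda>b. if b then return_pmf [u]
     else bind_pmf (geometric_pmf \<alpha>) (\<lambda>l. walk_pmf G u (Suc l)))"
    unfolding RW_def using \<alpha>_pos \<alpha>_less_1
    by (subst geometric_bind_pmf_unfold)
       (auto simp: bind_assoc_pmf bind_return_pmf bind_map_pmf intro!: bind_pmf_cong)
  \<comment> \<open>The remaining length and the first neighbour are independent, so they can be
    drawn in either order.\<close>
  also have "bind_pmf (geometric_pmf \<alpha>) (\<lambda>l. walk_pmf G u (Suc l)) =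
      map_pmf ((#) u) (bind_pmf (pmf_of_set (out_nbrs G u)) (RW G \<alpha>))"
    unfolding RW_def walk_pmf.simps map_bind_pmf[symmetric]
    by (subst bind_commute_pmf) simp
  finally show ?thesis .
qed

lemma RW_nonempty: "ws \<in> set_pmf (RW G \<alpha> u) \<Longrightarrow> ws \<noteq> []"
  by (subst (asm) RW_unfold) (auto split: if_splits)

text \<open>One-step analysis, the common source of the recursions for \<open>ppr\<close> and for
  the expected hit value.\<close>

lemma expectation_RW:
  fixes f :: "'a list \<Rightarrow> real"
  assumes "\<And>ws. \<bar>f ws\<bar> \<le> B"
  shows "measure_pmf.expectation (RW G \<alpha> u) f = \<alpha> * f [u] + (1 - \<alpha>) *
           measure_pmf.expectation (pmf_of_set (out_nbrs G u))
             (\<lambda>v. measure_pmf.expectation (RW G \<alpha> v) (\<lambda>ws. f (u # ws)))"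
  using assms \<alpha>_pos \<alpha>_less_1
  by (subst RW_unfold) (simp add: expectation_bind_pmf[where B = B])

lemma ppr_nonneg: "0 \<le> ppr G \<alpha> u t" and ppr_le_1: "ppr G \<alpha> u t \<le> 1"
  by (simp_all add: ppr_def)

lemma ppr_unfold:
  "ppr G \<alpha> u t = (if u = t then \<alpha> else 0) +
     (1 - \<alpha>) * measure_pmf.expectation (pmf_of_set (out_nbrs G u)) (\<lambda>v. ppr G \<alpha> v t)"
proof -
  have ppr_eq: "ppr G \<alpha> v t = measure_pmf.expectation (RW G \<alpha> v) (indicator {ws. last ws = t})" for v
    by (simp add: ppr_def)
  \<comment> \<open>\<open>last (u # ws)\<close> is \<open>last ws\<close> only for nonempty
    \<open>ws\<close>, hence the passage to the support.\<close>
  have "measure_pmf.expectation (RW G \<alpha> v) (\<lambda>ws. indicator {ws. last ws = t} (u # ws)) =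
      ppr G \<alpha> v t" for v
    unfolding ppr_eq
    by (rule integral_cong_AE) (auto simp: AE_measure_pmf_iff indicator_def dest: RW_nonempty)
  then show ?thesis
    unfolding ppr_eq[of u] by (subst expectation_RW[where B = 1]) auto
qed

text \<open>The walk stops at once with probability \<alpha>. With
  \<open>\<epsilon>\<^sub>r < \<alpha>\<close> this puts \<open>t\<close> into its own target
  set.\<close>

lemma ppr_self_ge: "\<alpha> \<le> ppr G \<alpha> t t"
proof -
  have "0 \<le> measure_pmf.expectation (pmf_of_set (out_nbrs G t)) (\<lambda>v. ppr G \<alpha> v t)"
    by (rule integral_nonneg_AE) (simp add: ppr_nonneg)
  then show ?thesis
    using \<alpha>_less_1 by (subst ppr_unfold) simp
qed

section \<open>The first hit of the frontier\<close>

lemma hit_value_nonneg: "0 \<le> hit_value G \<alpha> t h"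
  and abs_hit_value_le_1: "\<bar>hit_value G \<alpha> t h\<bar> \<le> 1"
  by (auto simp: hit_value_def ppr_nonneg ppr_le_1 split: option.split)

lemma frontier_hit_value_le:
  assumes "0 \<le> \<epsilon>"
  shows "hit_value G \<alpha> t (first_hit (frontier_set G \<alpha> \<epsilon> t) ws) \<le> \<epsilon>"
proof (cases "first_hit (frontier_set G \<alpha> \<epsilon> t) ws")
  case None
  then show ?thesis using assms by (simp add: hit_value_def)
next
  case (Some w)
  then have "w \<in> frontier_set G \<alpha> \<epsilon> t" by (auto simp: first_hit_def find_Some_iff)
  then have "w \<in> pverts G" "w \<notin> target_set G \<alpha> \<epsilon> t"
    by (auto simp: frontier_set_def in_nbrs_def dest: in_arcsD1)
  then show ?thesis using Some by (simp add: hit_value_def target_set_def)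
qed

text \<open>Membership of \<open>t\<close> in the target set keeps the stopping term \<alpha> out of
  the recursion for \<open>ppr\<close> at every node off that set.\<close>

lemma expectation_first_hit:
  assumes t: "t \<in> target_set G \<alpha> \<epsilon> t"
    and s: "s \<in> pverts G" "s \<notin> target_set G \<alpha> \<epsilon> t"
  shows "measure_pmf.expectation (RW G \<alpha> s)
           (\<lambda>ws. hit_value G \<alpha> t (first_hit (frontier_set G \<alpha> \<epsilon> t) ws)) = ppr G \<alpha> s t"
proof -
  let ?T = "target_set G \<alpha> \<epsilon> t" and ?F = "frontier_set G \<alpha> \<epsilon> t"
  define Y where "Y ws = hit_value G \<alpha> t (first_hit ?F ws)" for ws
  define g where "g u = measure_pmf.expectation (RW G \<alpha> u) Y" for u
  have Y_bd: "\<bar>Y ws\<bar> \<le> 1" for ws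
    by (simp add: Y_def abs_hit_value_le_1)
  have g_bd: "\<bar>g u\<bar> \<le> 1" for u
    unfolding g_def by (rule abs_expectation_le) (rule Y_bd)
  \<comment> \<open>A walk from a frontier node hits the frontier at its start, so \<open>Y\<close>
    is constant on these walks.\<close>
  have g_F: "g u = ppr G \<alpha> u t" if "u \<in> ?F" for u
    unfolding g_def using that
    by (subst expectation_RW[OF Y_bd]) (simp add: Y_def first_hit_def hit_value_def algebra_simps)
  have g_nF: "g u = (1 - \<alpha>) * measure_pmf.expectation (pmf_of_set (out_nbrs G u)) g" if "u \<notin> ?F" for u
  proof -
    have "Y [u] = 0" "Y (u # ws) = Y ws" for ws
      using that by (simp_all add: Y_def first_hit_def hit_value_def)
    then show ?thesis
      unfolding g_def by (subst expectation_RW[OF Y_bd]) simp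
  qed
  \<comment> \<open>Each application of the recursion gains a factor \<open>1 - \<alpha>\<close>; at
    \<open>n = 0\<close> both values lie between 0 and 1.\<close>
  have close: "\<bar>g u - ppr G \<alpha> u t\<bar> \<le> (1 - \<alpha>) ^ n" if "u \<in> pverts G" "u \<notin> ?T" for u n
    using that
  proof (induction n arbitrary: u)
    case 0
    have "0 \<le> g u" unfolding g_def
      by (rule integral_nonneg_AE) (simp add: Y_def hit_value_nonneg)
    then show ?case
      using g_bd[of u] ppr_nonneg[of u t] ppr_le_1[of u t] by simp
  next
    case (Suc n)
    show ?case
    proof (cases "u \<in> ?F")
      case True
      then show ?thesis using \<alpha>_less_1 by (simp add: g_F)
    next
      case False
      let ?N = "pmf_of_set (out_nbrs G u)"
      \<comment> \<open>An out-neighbour in \<open>?T\<close> would place \<open>u\<close> in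
        \<open>?F\<close>, so the recursion never leaves the complement of
        \<open>?T\<close>.\<close>
      have nbr: "v \<in> pverts G \<and> v \<notin> ?T" if "v \<in> set_pmf ?N" for v
        using that False Suc.prems set_pmf_of_out_nbrs[of u] out_nbrs_in_pverts[of v u]
        by (auto simp: frontier_set_def in_nbrs_def out_nbrs_def)
      have "u \<noteq> t" using Suc.prems t by blast
      then have "g u - ppr G \<alpha> u t =
          (1 - \<alpha>) * (measure_pmf.expectation ?N g - measure_pmf.expectation ?N (\<lambda>v. ppr G \<alpha> v t))"
        by (simp add: g_nF[OF False] ppr_unfold[of u] right_diff_distrib)
      also have "\<dots> = (1 - \<alpha>) * measure_pmf.expectation ?N (\<lambda>v. g v - ppr G \<alpha> v t)"
        by (subst Bochner_Integration.integral_diff)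
           (auto intro!: integrable_measure_pmf_bounded[where B = 1] simp: g_bd ppr_nonneg ppr_le_1)
      finally have "\<bar>g u - ppr G \<alpha> u t\<bar> =
          (1 - \<alpha>) * \<bar>measure_pmf.expectation ?N (\<lambda>v. g v - ppr G \<alpha> v t)\<bar>"
        using \<alpha>_less_1 by (simp add: abs_mult)
      also have "\<dots> \<le> (1 - \<alpha>) * (1 - \<alpha>) ^ n"
        using \<alpha>_less_1 nbr Suc.IH by (intro mult_left_mono abs_expectation_le) auto
      finally show ?thesis by simp
    qed
  qed
  have "(\<lambda>n. (1 - \<alpha>) ^ n) \<longlonglongrightarrow> 0"
    using \<alpha>_pos \<alpha>_less_1 by (intro LIMSEQ_power_zero) simp
  then have "\<bar>g s - ppr G \<alpha> s t\<bar> \<le> 0"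
    by (rule tendsto_lowerbound) (use close[OF s] in auto)
  then show ?thesis by (simp add: g_def Y_def[abs_def])
qed

end

section \<open>The accuracy of FAST-PPR\<close>

text \<open>1600 is the threshold at which \<open>16 / c\<close> equals 0.01. The first argument of
  the maximum is at least 384 * 8 = 3072.\<close>

lemma fast_ppr_const_gt: "fast_ppr_const > 1600"
proof -
  have "exp (4::real) \<le> 100"
  proof -
    have "exp (4::real) = exp 1 ^ 4" by (simp flip: exp_of_nat_mult)
    also have "\<dots> \<le> 3 ^ 4" by (intro power_mono exp_le) simp
    finally show ?thesis by simp
  qed
  then have "(4::real) \<le> ln 100" by (simp add: ln_ge_iff)
  moreover have "(2::real) \<le> exp 1" using exp_ge_add_one_self[of "1::real"] by simp
  ultimately have "(2::real) * 4 \<le> exp 1 * ln 100" by (intro mult_mono) auto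
  then show ?thesis by (simp add: fast_ppr_const_def less_max_iff_disj)
qed

theorem theorem3:
  fixes G :: "'a pair_pre_digraph" and \<alpha> \<delta> \<epsilon>\<^sub>r :: real and s t :: 'a
  assumes "pair_wf_digraph G"
    and "\<And>u. u \<in> pverts G \<Longrightarrow> out_degree G u \<ge> 1"
    and "0 < \<alpha>" and "\<alpha> < 1"
    and "s \<in> pverts G" and "t \<in> pverts G"
    and "\<delta> > 0"
    and "0 < \<epsilon>\<^sub>r" and "\<epsilon>\<^sub>r < \<alpha>"
  shows "measure_pmf.prob (fast_ppr G \<alpha> \<epsilon>\<^sub>r \<delta> s t)
           {est. \<bar>ppr G \<alpha> s t - est\<bar> \<le> max \<delta> (ppr G \<alpha> s t) / 4} > 0.99"
proof (cases "s \<in> target_set G \<alpha> \<epsilon>\<^sub>r t")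
  case True
  then show ?thesis
    using \<open>\<delta> > 0\<close> by (simp add: fast_ppr_def indicator_def)
next
  case False
  interpret pair_wf_digraph G by fact
  interpret ppr_digraph G \<alpha> by unfold_locales (use assms in auto)
  let ?F = "frontier_set G \<alpha> \<epsilon>\<^sub>r t"
  define p where "p = ppr G \<alpha> s t"
  define M where "M = max \<delta> p"
  define k where "k = num_walks \<epsilon>\<^sub>r \<delta>"
  define Y where "Y ws = hit_value G \<alpha> t (first_hit ?F ws)" for ws
  let ?R = "measure_pmf (replicate_pmf k (RW G \<alpha> s))"
  have "t \<in> target_set G \<alpha> \<epsilon>\<^sub>r t"
    using assms ppr_self_ge[of t] by (simp add: target_set_def)
  then have mean: "measure_pmf.expectation (RW G \<alpha> s) Y = p"
    unfolding p_def Y_def by (rule expectation_first_hit) (use assms False in auto)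
  have M: "M > 0" "\<delta> \<le> M" "p \<le> M" "0 \<le> p"
    using \<open>\<delta> > 0\<close> by (auto simp: M_def p_def ppr_nonneg)
  have k_ge: "fast_ppr_const * \<epsilon>\<^sub>r / \<delta> \<le> real k"
    unfolding k_def num_walks_def by linarith
  have "1600 * \<epsilon>\<^sub>r < fast_ppr_const * \<epsilon>\<^sub>r"
    using fast_ppr_const_gt \<open>0 < \<epsilon>\<^sub>r\<close> by simp
  also have "\<dots> \<le> real k * \<delta>"
    using k_ge \<open>\<delta> > 0\<close> by (simp add: field_simps)
  also have "\<dots> \<le> real k * M" using M by (simp add: mult_left_mono)
  finally have k_M: "1600 * \<epsilon>\<^sub>r < real k * M" .
  then have "k > 0" using \<open>0 < \<epsilon>\<^sub>r\<close> by (cases k) auto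
  have "measure ?R {xs. \<bar>(\<Sum>ws\<leftarrow>xs. Y ws) / real k - p\<bar> \<ge> M / 4} \<le> \<epsilon>\<^sub>r * p / (real k * (M / 4)\<^sup>2)"
    using prob_replicate_pmf_deviation[of "RW G \<alpha> s" Y \<epsilon>\<^sub>r k "M / 4"] \<open>k > 0\<close> M \<open>0 < \<epsilon>\<^sub>r\<close>
    by (simp add: mean Y_def hit_value_nonneg frontier_hit_value_le)
  \<comment> \<open>Replacing \<open>p\<close> by \<open>M\<close> cancels one factor of the squared
    tolerance and treats \<open>p\<close> below and above \<delta> alike.\<close>
  also have "\<dots> \<le> \<epsilon>\<^sub>r * M / (real k * (M / 4)\<^sup>2)"
    using M \<open>0 < \<epsilon>\<^sub>r\<close> by (intro divide_right_mono mult_left_mono) auto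
  also have "\<dots> = 16 * \<epsilon>\<^sub>r / (real k * M)"
    using M by (simp add: power2_eq_square)
  also have "\<dots> < 0.01"
    using k_M M \<open>k > 0\<close> by (simp add: field_simps)
  finally have bad: "measure ?R {xs. \<bar>(\<Sum>ws\<leftarrow>xs. Y ws) / real k - p\<bar> \<ge> M / 4} < 0.01" .
  have "1 - measure ?R {xs. \<bar>(\<Sum>ws\<leftarrow>xs. Y ws) / real k - p\<bar> \<ge> M / 4} =
      measure ?R (- {xs. \<bar>(\<Sum>ws\<leftarrow>xs. Y ws) / real k - p\<bar> \<ge> M / 4})"
    using measure_pmf.prob_compl[of "{xs. \<bar>(\<Sum>ws\<leftarrow>xs. Y ws) / real k - p\<bar> \<ge> M / 4}"
        "replicate_pmf k (RW G \<alpha> s)"] by (simp add: Compl_eq_Diff_UNIV)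
  \<comment> \<open>The complement of the bad event is a strict deviation bound, hence contained in
    the required event.\<close>
  also have "\<dots> \<le> measure ?R {xs. \<bar>p - (\<Sum>ws\<leftarrow>xs. Y ws) / real k\<bar> \<le> M / 4}"
    by (intro measure_pmf.finite_measure_mono) (auto simp: abs_minus_commute)
  finally have "measure ?R {xs. \<bar>p - (\<Sum>ws\<leftarrow>xs. Y ws) / real k\<bar> \<le> M / 4} > 0.99"
    using bad by simp
  then show ?thesis
    using False by (simp add: fast_ppr_def Let_def vimage_def
        flip: p_def M_def k_def Y_def)
qed

end
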